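(* There is a constant $b>0$ such that for each integer $k\ge 50$ there is an infinite class $\mathbf{G}$ of graphs of maximum degree at most $5$, each of treewidth at most $k$, such that for each $G\in\mathbf{G}$, $\mathrm{dmw}(G)\ge (\log_2 n\cdot k)/b$, where $n=|V(G)|$.
   Context: A matching $M$ of $G$ is distant if no two vertices incident to distinct edges of $M$ are adjacent or have a common neighbour. $\mathrm{dmw}(G)$ (distant matching width) is the minimum, over all orderings $SV$ of $V(G)$, of the maximum, over all prefixes $V_1$ of $SV$, of the size of a largest distant matching all of whose edges have one end in $V_1$ and the other in $V(G)\setminus V_1$. *)

theory Defs
  imports
    Complex_Main
    "HOL-Library.Sublist"
    "HOL-Combinatorics.Multiset_Permutations"
    "Graph_Theory.Graph_Theory"
begin

text \<open>
  A finite simple graph is a \<^locale>\<open>pair_graph\<close>: a finite, loop-free digraph whose arc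
  relation is symmetric, so that each undirected edge is represented by its two opposite arcs.
\<close>

definition uedges :: "'a pair_pre_digraph \<Rightarrow> 'a set set" where
  "uedges G = {{u, v} | u v. (u, v) \<in> parcs G}"

text \<open>
  The library predicate \<^const>\<open>tree\<close> is unsuitable for symmetric digraphs, because
  \<^const>\<open>pre_digraph.cycle\<close> counts the walk \<open>a, b, a\<close> along two opposite arcs as a cycle.
  In a \<^locale>\<open>pair_graph\<close> the undirected cycles are the library cycles of length at least 3.
  The predicate \<open>connected\<close> includes nonemptiness of the vertex set.
\<close>

definition undirected_tree :: "'t pair_pre_digraph \<Rightarrow> bool" where
  "undirected_tree T \<longleftrightarrow>
     pair_graph T \<and> Digraph_Component.connected (with_proj T) \<and>
     \<not> (\<exists>p. pre_digraph.cycle (with_proj T) p \<and> 3 \<le> length p)"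

definition tree_decomposition ::
    "'a pair_pre_digraph \<Rightarrow> 't pair_pre_digraph \<Rightarrow> ('t \<Rightarrow> 'a set) \<Rightarrow> bool" where
  "tree_decomposition G T B \<longleftrightarrow>
     undirected_tree T \<and>
     (\<Union>t\<in>pverts T. B t) = pverts G \<and>
     (\<forall>e\<in>uedges G. \<exists>t\<in>pverts T. e \<subseteq> B t) \<and>
     (\<forall>v\<in>pverts G. Digraph_Component.connected (with_proj T \<restriction> {t \<in> pverts T. v \<in> B t}))"

text \<open>
  Subtraction is truncated, so the graph without vertices gets treewidth 0 rather than the
  conventional -1. Decomposition trees are finite, hence natural numbers suffice as their nodes.
\<close>

definition decomposition_width :: "'t pair_pre_digraph \<Rightarrow> ('t \<Rightarrow> 'a set) \<Rightarrow> nat" where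
  "decomposition_width T B = Max ((\<lambda>t. card (B t)) ` pverts T) - 1"

definition treewidth :: "'a pair_pre_digraph \<Rightarrow> nat" where
  "treewidth G =
     (LEAST w. \<exists>(T :: nat pair_pre_digraph) B.
        tree_decomposition G T B \<and> decomposition_width T B = w)"

definition matching :: "'a pair_pre_digraph \<Rightarrow> 'a set set \<Rightarrow> bool" where
  "matching G M \<longleftrightarrow> M \<subseteq> uedges G \<and> pairwise disjnt M"

definition distant_matching :: "'a pair_pre_digraph \<Rightarrow> 'a set set \<Rightarrow> bool" where
  "distant_matching G M \<longleftrightarrow>
     matching G M \<and>
     (\<forall>e\<in>M. \<forall>f\<in>M. e \<noteq> f \<longrightarrow>
        (\<forall>u\<in>e. \<forall>v\<in>f. (u, v) \<notin> parcs G \<and> \<not> (\<exists>w. (u, w) \<in> parcs G \<and> (v, w) \<in> parcs G)))"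

definition crosses :: "'a pair_pre_digraph \<Rightarrow> 'a set \<Rightarrow> 'a set \<Rightarrow> bool" where
  "crosses G V1 e \<longleftrightarrow> (\<exists>u\<in>V1. \<exists>v\<in>pverts G - V1. e = {u, v})"

definition max_crossing_distant_matching :: "'a pair_pre_digraph \<Rightarrow> 'a set \<Rightarrow> nat" where
  "max_crossing_distant_matching G V1 =
     Max {card M | M. distant_matching G M \<and> (\<forall>e\<in>M. crosses G V1 e)}"

definition dmw :: "'a pair_pre_digraph \<Rightarrow> nat" where
  "dmw G =
     Min ((\<lambda>SV. Max ((\<lambda>xs. max_crossing_distant_matching G (set xs)) ` set (prefixes SV)))
          ` permutations_of_set (pverts G))"

end

theory Submission
  imports Defs
begin

text \<open>
  The graphs are the products of complete binary trees with a path on \<open>p \<approx> k / 2\<close> vertices: the copies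
  of a tree node and its parent form bags of size \<open>2p\<close>. In a graph of bounded degree a maximum
  distant matching across a cut has size linear in the number of cut edges, so it suffices that every
  vertex ordering has a prefix with \<open>\<Omega>(p log n)\<close> cut edges. Across a connected subtree, a cut with \<open>p\<close>
  columns meeting either side has at least \<open>p\<close> edges; passing from the subtrees at the grandchildren of
  a node to the whole subtree gains \<open>p\<close> edges, so the cut grows by \<open>p\<close> for every two levels.
\<close>

section \<open>The complete binary tree in heap numbering\<close>

text \<open>The root is 1, and the children of \<open>t\<close> are \<open>2 * t\<close> and
  \<open>2 * t + 1\<close>. The relation also holds for the spurious pairs \<open>0, 0\<close> and
  \<open>0, 1\<close>, so node sets start at 1.\<close>

definition heap_adj :: "nat \<Rightarrow> nat \<Rightarrow> bool" where
  "heap_adj s t \<longleftrightarrow> s = t div 2 \<or> t = s div 2"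

lemma heap_adj_sym: "heap_adj s t \<longleftrightarrow> heap_adj t s"
  by (auto simp: heap_adj_def)

definition heap_tree :: "nat \<Rightarrow> nat pair_pre_digraph" where
  "heap_tree h =
     \<lparr>pverts = {1..<2 ^ h}, parcs = {(s, t). s \<in> {1..<2 ^ h} \<and> t \<in> {1..<2 ^ h} \<and> heap_adj s t}\<rparr>"

text \<open>These are the connected node sets with topmost node \<open>r\<close>, encoded by closure
  under parents so that induction on numbers replaces arguments about paths.\<close>

definition rooted :: "nat \<Rightarrow> nat set \<Rightarrow> bool" where
  "rooted r S \<longleftrightarrow> r \<in> S \<and> 0 \<notin> S \<and> (\<forall>a\<in>S. a \<noteq> r \<longrightarrow> a div 2 \<in> S)"

text \<open>Climbing from \<open>a\<close> to \<open>r\<close> through ever smaller parents never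
  changes the truth value of \<open>P\<close>.\<close>

lemma rooted_const:
  assumes "rooted r S" "\<And>a. a \<in> S \<Longrightarrow> a \<noteq> r \<Longrightarrow> P a \<longleftrightarrow> P (a div 2)" "a \<in> S"
  shows "P a \<longleftrightarrow> P r"
  using assms(3)
proof (induction a rule: less_induct)
  case (less a)
  show ?case
  proof (cases "a = r")
    case False
    have "a > 0" "a div 2 \<in> S"
      using less.prems assms(1) False by (auto simp: rooted_def intro: gr0I)
    then show ?thesis
      using less.IH[of "a div 2"] assms(2)[OF less.prems False] by simp
  qed simp
qed

text \<open>Otherwise \<open>P\<close> would agree along every parent link and hence be constant on
  \<open>S\<close>.\<close>

lemma rooted_heap_edge:
  assumes "rooted r S" "a \<in> S" "b \<in> S" "P a" "\<not> P b"
  shows "\<exists>s\<in>S. \<exists>t\<in>S. heap_adj s t \<and> P s \<and> \<not> P t"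
proof -
  obtain c where c: "c \<in> S" "c \<noteq> r" "P c \<noteq> P (c div 2)"
    using rooted_const[OF assms(1), of P] assms(2-) by metis
  moreover have "c div 2 \<in> S" using c assms(1) by (auto simp: rooted_def)
  ultimately show ?thesis by (cases "P c") (auto simp: heap_adj_def)
qed

text \<open>Every node climbs to \<open>r\<close> through its parents, and symmetry gives the way
  back.\<close>

lemma connected_rooted:
  assumes "rooted r S" "S \<subseteq> {1..<2 ^ h}"
  shows "Digraph_Component.connected (with_proj (heap_tree h) \<restriction> S)"
proof -
  \<comment> \<open>Connectedness means strong connectivity of the symmetric closure, which adds no
    arcs here because \<open>heap_adj\<close> is symmetric.\<close>
  define G where "G = mk_symmetric (with_proj (heap_tree h) \<restriction> S)"
  have verts: "pverts G = S" by (simp add: G_def mk_symmetric_def)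
  have arcs: "parcs G = {(s, t). s \<in> S \<and> t \<in> S \<and> heap_adj s t}"
  proof -
    have "1 \<le> s" "s < 2 ^ h" if "s \<in> S" for s using assms(2) that by auto
    then show ?thesis
      using heap_adj_sym by (auto simp: G_def mk_symmetric_def heap_tree_def) blast
  qed
  interpret pair_sym_digraph G
  proof unfold_locales
    show "symmetric (with_proj G)"
      unfolding symmetric_def with_proj_simps arcs by (rule symI) (simp add: heap_adj_sym)
  qed (simp_all add: verts arcs split: prod.splits)
  have reach: "a \<rightarrow>\<^sup>*\<^bsub>with_proj G\<^esub> r" if "a \<in> S" for a
    using that
  proof (induction a rule: less_induct)
    case (less a)
    show ?case
    proof (cases "a = r")
      case True
      then show ?thesis using less.prems verts by simp
    next
      case False
      have a: "a > 0" "a div 2 \<in> S"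
        using less.prems assms(1) False by (auto simp: rooted_def intro: gr0I)
      have "(a, a div 2) \<in> parcs G" using a less.prems by (auto simp: arcs heap_adj_def)
      then show ?thesis using less.IH[of "a div 2"] a by (auto intro: adj_reachable_trans)
    qed
  qed
  have "strongly_connected (with_proj G)"
    unfolding strongly_connected_def
  proof (intro conjI ballI)
    show "verts (with_proj G) \<noteq> {}" using assms(1) verts by (auto simp: rooted_def)
    fix u v assume "u \<in> verts (with_proj G)" "v \<in> verts (with_proj G)"
    then have "u \<rightarrow>\<^sup>*\<^bsub>with_proj G\<^esub> r" "r \<rightarrow>\<^sup>*\<^bsub>with_proj G\<^esub> v"
      using reach symmetric_reachable' by (simp_all add: verts)
    then show "u \<rightarrow>\<^sup>*\<^bsub>with_proj G\<^esub> v" by (rule reachable_trans)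
  qed
  then show ?thesis by (simp add: G_def connected_def)
qed

section \<open>The heap tree is an undirected tree\<close>

lemma rooted_heap: "h > 0 \<Longrightarrow> rooted 1 {1..<2 ^ h}"
proof -
  assume "h > 0"
  then have "(1::nat) < 2 ^ h" by (intro one_less_power) auto
  then show ?thesis by (auto simp: rooted_def)
qed

lemma pair_graph_heap_tree: "pair_graph (heap_tree h)"
proof (unfold_locales, goal_cases)
  case 4
  have "parcs (heap_tree h) \<subseteq> {1..<2 ^ h} \<times> {1..<2 ^ h}" by (auto simp: heap_tree_def)
  then show ?case by (rule finite_subset) simp
qed (auto simp: heap_tree_def heap_adj_def symmetric_def intro!: symI)

text \<open>Both neighbours of the largest node \<open>m\<close> of a cycle are at most
  \<open>m\<close>, so both are its parent \<open>m div 2\<close>. On a cycle with at least 3 arcs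
  they would have to differ.\<close>

lemma heap_tree_no_cycle:
  assumes "pre_digraph.cycle (with_proj (heap_tree h)) p"
  shows "length p < 3"
proof -
  interpret pair_graph "heap_tree h" by (rule pair_graph_heap_tree)
  obtain u where u: "awalk u p u" "distinct (tl (awalk_verts u p))" "p \<noteq> []"
    using assms by (auto simp: cycle_def)
  have sub: "set p \<subseteq> parcs (heap_tree h)" using u(1) by auto
  have heads: "distinct (map snd p)"
    using u awalk_verts_conv'[of u p u] by (auto simp: awalk_def)
  define m where "m = Max (snd ` set p)"
  have max: "a \<le> m" if "a \<in> snd ` set p" for a unfolding m_def using that by (intro Max_ge) auto
  have "m \<in> snd ` set p" unfolding m_def using u(3) by (intro Max_in) auto
  then obtain b where "(b, m) \<in> set p" by auto
  then obtain x y where p: "p = x @ (b, m) # y" by (meson split_list)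
  have rot: "awalk m (y @ x @ [(b, m)]) m"
    using u(1) unfolding p by (auto simp: awalk_simps simp del: awalk_verts_with_proj_eq)
  show ?thesis
  proof (rule ccontr)
    assume "\<not> length p < 3"
    then have "length (y @ x) \<ge> 2" by (simp add: p)
    \<comment> \<open>Length at least 3 leaves arcs \<open>mid\<close> between the first arc
      \<open>e\<close> out of \<open>m\<close> and the last arc \<open>(b, m)\<close>. The heads of
      \<open>e\<close> and \<open>last mid\<close> are then the two neighbours of \<open>m\<close>,
      at different positions of the cycle.\<close>
    then obtain e mid where yx: "y @ x = e # mid" and mid: "mid \<noteq> []"
      by (cases "y @ x" rule: list.exhaust; cases "tl (y @ x)") auto
    have rot': "awalk m (e # mid @ [(b, m)]) m" using rot yx by (metis append_Cons append_assoc)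
    then obtain a where e: "e = (m, a)" by (cases e) (auto simp: awalk_Cons_iff)
    have walk: "awalk a (mid @ [(b, m)]) m" using rot' e awalk_Cons_iff[of m e "mid @ [(b, m)]" m] by simp
    then have "awlast a mid = b" by (auto simp: awalk_simps)
    then have b: "b = snd (last mid)" using mid by (simp add: awalk_verts_conv)
    have "set p = insert (b, m) (insert e (set mid))" using arg_cong[OF yx, of set] by (auto simp: p)
    then have in_p: "(b, m) \<in> set p" "(m, a) \<in> set p" "last mid \<in> set p" using e mid by auto
    have "a \<le> m" "b \<le> m" using max in_p b by force+
    moreover have "heap_adj b m" "heap_adj m a" "m > 0"
      using in_p sub by (auto simp: heap_tree_def)
    ultimately have "a = b" by (auto simp: heap_adj_def)
    moreover have "distinct (map snd (y @ x))" using heads by (auto simp: p)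
    then have "a \<noteq> snd (last mid)" unfolding yx using e mid by auto
    ultimately show False using b by simp
  qed
qed

lemma undirected_tree_heap_tree:
  assumes "h > 0"
  shows "undirected_tree (heap_tree h)"
proof -
  have "with_proj (heap_tree h) \<restriction> {1..<2 ^ h} = with_proj (heap_tree h)"
    by (auto simp: heap_tree_def induce_subgraph_def with_proj_def)
  then show ?thesis
    using connected_rooted[OF rooted_heap[OF assms] subset_refl] pair_graph_heap_tree heap_tree_no_cycle
    by (fastforce simp: undirected_tree_def)
qed

section \<open>The product of the tree with a path\<close>

text \<open>Cartesian product of the tree with a path. Requiring equal quotients for consecutive
  numbers rules out a step from the last row of one node to row 0 of the next.\<close>

definition grid_adj :: "nat \<Rightarrow> nat \<Rightarrow> nat \<Rightarrow> bool" where
  "grid_adj p u v \<longleftrightarrow>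
     u div p = v div p \<and> (u = Suc v \<or> v = Suc u) \<or> u mod p = v mod p \<and> heap_adj (u div p) (v div p)"

text \<open>The vertex \<open>t * p + i\<close> with \<open>i < p\<close> is the copy of the tree node \<open>t\<close> in row \<open>i\<close>.\<close>

definition heap_grid :: "nat \<Rightarrow> nat \<Rightarrow> nat pair_pre_digraph" where
  "heap_grid p h =
     \<lparr>pverts = {p..<p * 2 ^ h}, parcs = {(u, v). u \<in> {p..<p * 2 ^ h} \<and> v \<in> {p..<p * 2 ^ h} \<and> grid_adj p u v}\<rparr>"

lemma heap_grid_vert_iff:
  fixes p u :: nat
  assumes "p > 0"
  shows "u \<in> {p..<p * 2 ^ h} \<longleftrightarrow> u div p \<in> {1..<2 ^ h}"
  using assms by (auto simp: div_less_iff_less_mult less_eq_div_iff_mult_less_eq mult.commute Suc_le_eq div_greater_zero_iff)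

lemma pair_graph_heap_grid:
  assumes "p > 0"
  shows "pair_graph (heap_grid p h)"
proof (unfold_locales, goal_cases)
  case 4
  have "parcs (heap_grid p h) \<subseteq> {p..<p * 2 ^ h} \<times> {p..<p * 2 ^ h}" by (auto simp: heap_grid_def)
  then show ?case by (rule finite_subset) simp
next
  case (5 e)
  \<comment> \<open>Positivity excludes the loop \<open>heap_adj 0 0\<close>.\<close>
  then have "fst e div p > 0" using assms by (auto simp: heap_grid_def div_greater_zero_iff)
  with 5 show ?case by (auto simp: heap_grid_def grid_adj_def heap_adj_def)
qed (auto simp: heap_grid_def grid_adj_def heap_adj_def symmetric_def sym_def)

text \<open>Two path neighbours, the parent and the two children: the source of the degree bound
  5.\<close>

lemma grid_adj_cases:
  assumes "p > 0" "grid_adj p u v"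
  shows "v \<in> {u - 1, Suc u, u div p div 2 * p + u mod p, (2 * (u div p)) * p + u mod p, (2 * (u div p) + 1) * p + u mod p}"
proof -
  have v: "v = v div p * p + v mod p" by simp
  consider "u = Suc v" | "v = Suc u" | "u mod p = v mod p" "v div p = u div p div 2"
    | "u mod p = v mod p" "u div p = v div p div 2"
    using assms by (auto simp: grid_adj_def heap_adj_def)
  then show ?thesis
  proof cases
    case 4
    then have "v div p = 2 * (u div p) \<or> v div p = 2 * (u div p) + 1" by linarith
    then show ?thesis using v 4 by (metis insertCI)
  next
    case 3
    then show ?thesis using v by (metis insertCI)
  qed auto
qed

lemma card_heap_grid_neighbours:
  assumes "p > 0"
  shows "card {w. (v, w) \<in> parcs (heap_grid p h)} \<le> 5"
proof -
  let ?L = "[v - 1, Suc v, v div p div 2 * p + v mod p, (2 * (v div p)) * p + v mod p, (2 * (v div p) + 1) * p + v mod p]"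
  have sub: "{w. (v, w) \<in> parcs (heap_grid p h)} \<subseteq> set ?L"
    using grid_adj_cases[OF assms, of v] by (auto simp: heap_grid_def)
  have "card {w. (v, w) \<in> parcs (heap_grid p h)} \<le> card (set ?L)" using sub by (intro card_mono) auto
  also have "\<dots> \<le> length ?L" by (rule card_length)
  finally show "card {w. (v, w) \<in> parcs (heap_grid p h)} \<le> 5" by simp
qed

lemma out_degree_with_proj:
  "out_degree (with_proj G) v = card {w. (v, w) \<in> parcs G}"
proof -
  have "out_arcs (with_proj G) v = Pair v ` {w. (v, w) \<in> parcs G}" by (auto simp: out_arcs_def)
  then show ?thesis by (simp add: out_degree_def card_image inj_on_def)
qed

section \<open>Tree decomposition and treewidth of the product\<close>

text \<open>The first conjunct discards node 0, which \<open>t div 2\<close> yields as a fictitious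
  parent of the root.\<close>

definition heap_bag :: "nat \<Rightarrow> nat \<Rightarrow> nat set" where
  "heap_bag p t = {v. v div p \<noteq> 0 \<and> (v div p = t \<or> v div p = t div 2)}"

lemma card_heap_bag:
  assumes "p > 0"
  shows "card (heap_bag p t) \<le> 2 * p"
proof -
  have "heap_bag p t \<subseteq> {t * p..<t * p + p} \<union> {t div 2 * p..<t div 2 * p + p}"
  proof
    fix v assume "v \<in> heap_bag p t"
    moreover have "v div p * p \<le> v" "v < v div p * p + p"
      using dividend_less_div_times[OF assms, of v] by (simp_all add: add.commute)
    ultimately show "v \<in> {t * p..<t * p + p} \<union> {t div 2 * p..<t div 2 * p + p}"
      unfolding heap_bag_def by (metis (mono_tags, lifting) UnI1 UnI2 atLeastLessThan_iff mem_Collect_eq)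
  qed
  then have "card (heap_bag p t) \<le> card ({t * p..<t * p + p} \<union> {t div 2 * p..<t div 2 * p + p})"
    by (intro card_mono) auto
  also have "\<dots> \<le> card {t * p..<t * p + p} + card {t div 2 * p..<t div 2 * p + p}" by (rule card_Un_le)
  finally show ?thesis by simp
qed

lemma tree_decomposition_heap_grid:
  assumes "p > 0" "h > 0"
  shows "tree_decomposition (heap_grid p h) (heap_tree h) (heap_bag p)"
proof -
  have verts: "v \<in> pverts (heap_grid p h) \<longleftrightarrow> v div p \<in> {1..<2 ^ h}" for v
    using heap_grid_vert_iff[OF assms(1)] by (simp add: heap_grid_def)
  have "(\<Union>t\<in>pverts (heap_tree h). heap_bag p t) = pverts (heap_grid p h)"
    by (force simp: set_eq_iff verts heap_bag_def heap_tree_def)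
  moreover have "\<exists>t\<in>pverts (heap_tree h). e \<subseteq> heap_bag p t" if "e \<in> uedges (heap_grid p h)" for e
  proof -
    obtain u v where e: "e = {u, v}" "(u, v) \<in> parcs (heap_grid p h)"
      using \<open>e \<in> _\<close> by (auto simp: uedges_def)
    have uv: "u div p \<in> {1..<2 ^ h}" "v div p \<in> {1..<2 ^ h}"
      using e(2) verts[of u] verts[of v] by (auto simp: heap_grid_def)
    have "u div p = v div p \<or> heap_adj (u div p) (v div p)"
      using e(2) by (auto simp: heap_grid_def grid_adj_def)
    \<comment> \<open>An edge between a parent and a child lies in the bag of the child.\<close>
    then have "e \<subseteq> heap_bag p (u div p) \<or> e \<subseteq> heap_bag p (v div p)"
      using uv by (auto simp: e(1) heap_bag_def heap_adj_def)
    then show ?thesis using uv by (auto simp: heap_tree_def)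
  qed
  moreover have "Digraph_Component.connected
      (with_proj (heap_tree h) \<restriction> {t \<in> pverts (heap_tree h). v \<in> heap_bag p t})"
    if "v \<in> pverts (heap_grid p h)" for v
  proof (rule connected_rooted)
    \<comment> \<open>The bags containing \<open>v\<close> belong to its own node and to the
      children of that node in the tree.\<close>
    show "rooted (v div p) {t \<in> pverts (heap_tree h). v \<in> heap_bag p t}"
      using that verts[of v] by (auto simp: rooted_def heap_tree_def heap_bag_def)
  qed (auto simp: heap_tree_def)
  ultimately show ?thesis
    using undirected_tree_heap_tree[OF assms(2)] by (simp add: tree_decomposition_def)
qed

lemma treewidth_heap_grid:
  assumes "p > 0" "h > 0"
  shows "treewidth (heap_grid p h) \<le> 2 * p - 1"
proof -
  have "treewidth (heap_grid p h) \<le> decomposition_width (heap_tree h) (heap_bag p)"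
    unfolding treewidth_def using tree_decomposition_heap_grid[OF assms] by (intro Least_le) blast
  also have "\<dots> \<le> 2 * p - 1"
    unfolding decomposition_width_def
    using assms card_heap_bag one_less_power[of "2::nat" h]
    by (intro diff_le_mono Max.boundedI) (auto simp: heap_tree_def)
  finally show ?thesis .
qed

section \<open>Edge cuts of the product\<close>

text \<open>Only arcs directed out of \<open>X\<close> are kept, so each cut edge counts once.
  Having both ends over \<open>S\<close> makes the cuts over disjoint node sets disjoint.\<close>

definition cut_arcs :: "nat \<Rightarrow> nat set \<Rightarrow> nat set \<Rightarrow> (nat \<times> nat) set" where
  "cut_arcs p S X = {(u, v). u \<in> X \<and> v \<notin> X \<and> u div p \<in> S \<and> v div p \<in> S \<and> grid_adj p u v}"

text \<open>A column consists of the \<open>p\<close> copies of one node. With \<open>- X\<close> in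
  place of \<open>X\<close> these are the columns not contained in \<open>X\<close>.\<close>

definition touched :: "nat \<Rightarrow> nat set \<Rightarrow> nat set \<Rightarrow> nat set" where
  "touched p S X = S \<inter> (\<lambda>v. v div p) ` X"

lemma finite_cut_arcs:
  assumes "p > 0" "finite S"
  shows "finite (cut_arcs p S X)"
proof -
  have "v \<in> (\<Union>t\<in>S. {t * p..<t * p + p})" if "v div p \<in> S" for v
    using that dividend_less_div_times[OF assms(1), of v] by (auto intro!: bexI[of _ "v div p"])
  then have "cut_arcs p S X \<subseteq> (\<Union>t\<in>S. {t * p..<t * p + p}) \<times> (\<Union>t\<in>S. {t * p..<t * p + p})"
    by (auto simp: cut_arcs_def)
  then show ?thesis by (rule finite_subset) (use assms(2) in auto)
qed

lemma path_change:
  fixes p i j :: nat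
  assumes "i < p" "j < p" "Q i" "\<not> Q j"
  shows "\<exists>k<p. \<exists>l<p. Q k \<and> \<not> Q l \<and> (k = Suc l \<or> l = Suc k)"
proof (rule ccontr)
  assume no: "\<not> ?thesis"
  have "k < p \<Longrightarrow> Q k = Q 0" for k
  proof (induction k)
    case (Suc k)
    then show ?case using no by (metis Suc_lessD)
  qed simp
  then show False using assms by blast
qed

text \<open>A mixed column has consecutive vertices on different sides. Phrasing this as membership
  in an image of the cut bounds the number of such columns by the number of cut arcs.\<close>

lemma mixed_column_cut:
  assumes "t \<in> S" "i < p" "j < p" "t * p + i \<in> X" "t * p + j \<notin> X"
  shows "t \<in> (\<lambda>e. fst e div p) ` cut_arcs p S X"
proof -
  obtain k l where "k < p" "l < p" "t * p + k \<in> X" "t * p + l \<notin> X" "k = Suc l \<or> l = Suc k"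
    using path_change[of i p j "\<lambda>i. t * p + i \<in> X"] assms by blast
  then have "(t * p + k, t * p + l) \<in> cut_arcs p S X"
    using assms(1) by (auto simp: cut_arcs_def grid_adj_def)
  moreover have "t = fst (t * p + k, t * p + l) div p" using \<open>k < p\<close> by simp
  ultimately show ?thesis by (rule rev_image_eqI)
qed

text \<open>A row is a copy of the connected set \<open>S\<close>, so a mixed row contains a cut arc
  along a tree edge.\<close>

lemma mixed_row_cut:
  assumes "rooted r S" "a \<in> S" "b \<in> S" "i < p" "a * p + i \<in> X" "b * p + i \<notin> X"
  shows "i \<in> (\<lambda>e. fst e mod p) ` cut_arcs p S X"
proof -
  obtain s t where "s \<in> S" "t \<in> S" "heap_adj s t" "s * p + i \<in> X" "t * p + i \<notin> X"
    using rooted_heap_edge[OF assms(1-3), of "\<lambda>a. a * p + i \<in> X"] assms by blast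
  then have "(s * p + i, t * p + i) \<in> cut_arcs p S X"
    using assms(4) by (auto simp: cut_arcs_def grid_adj_def)
  moreover have "i = fst (s * p + i, t * p + i) mod p" using \<open>i < p\<close> by simp
  ultimately show ?thesis by (rule rev_image_eqI)
qed

lemma touchedE:
  assumes "t \<in> touched p S X" "p > 0"
  obtains j where "t \<in> S" "j < p" "t * p + j \<in> X"
proof -
  obtain v where v: "v \<in> X" "t = v div p" "t \<in> S" using assms(1) by (auto simp: touched_def)
  show thesis by (rule that[of "v mod p"]) (use v assms(2) in simp_all)
qed

text \<open>
  If every row is mixed, each row contributes a vertical arc; otherwise some row lies entirely on one
  side, and every column meeting the other side contributes a horizontal arc.
\<close>

lemma card_cut_arcs_ge:
  assumes "p > 0" "finite S" "rooted r S"
    and "p \<le> card (touched p S X)" "p \<le> card (touched p S (- X))"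
  shows "p \<le> card (cut_arcs p S X)"
proof -
  have fin: "finite (cut_arcs p S X)" by (rule finite_cut_arcs[OF assms(1,2)])
  have le: "card A \<le> card (cut_arcs p S X)" if "A \<subseteq> f ` cut_arcs p S X" for A and f :: "nat \<times> nat \<Rightarrow> nat"
    using surj_card_le[OF fin that] .
  consider "\<forall>i<p. (\<exists>a\<in>S. a * p + i \<in> X) \<and> (\<exists>b\<in>S. b * p + i \<notin> X)"
    | i where "i < p" "\<forall>a\<in>S. a * p + i \<in> X" | i where "i < p" "\<forall>a\<in>S. a * p + i \<notin> X"
    by blast
  then show ?thesis
  proof cases
    case 1
    then have "{..<p} \<subseteq> (\<lambda>e. fst e mod p) ` cut_arcs p S X"
      using mixed_row_cut[OF assms(3)] by blast
    from le[OF this] show ?thesis by simp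
  next
    case 2
    then have "touched p S (- X) \<subseteq> (\<lambda>e. fst e div p) ` cut_arcs p S X"
      using mixed_column_cut by (auto elim!: touchedE[OF _ assms(1)])
    from le[OF this] show ?thesis using assms(5) by simp
  next
    case 3
    then have "touched p S X \<subseteq> (\<lambda>e. fst e div p) ` cut_arcs p S X"
      using mixed_column_cut by (auto elim!: touchedE[OF _ assms(1)])
    from le[OF this] show ?thesis using assms(4) by simp
  qed
qed

section \<open>Complete subtrees and the subtrees at grandchildren\<close>

text \<open>The complete subtree with \<open>d\<close> levels below \<open>t\<close>; the exponent
  \<open>j\<close> is the depth of \<open>a\<close> below \<open>t\<close>.\<close>

definition subheap :: "nat \<Rightarrow> nat \<Rightarrow> nat set" where
  "subheap t d = {a. \<exists>j<d. a div 2 ^ j = t}"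

text \<open>Two different depths would give \<open>t = t div 2 ^ k\<close> with
  \<open>k > 0\<close>, impossible for positive \<open>t\<close>.\<close>

lemma subheap_level_unique:
  fixes a :: nat
  assumes "a div 2 ^ i = t" "a div 2 ^ j = t" "t > 0"
  shows "i = j"
proof -
  have less: "\<not> i < j" if "a div 2 ^ i = t" "a div 2 ^ j = t" for i j
  proof
    assume "i < j"
    then have "(2::nat) ^ j = 2 ^ i * 2 ^ (j - i)" by (simp flip: power_add)
    then have "t div 2 ^ (j - i) = t" using that by (simp add: div_mult2_eq)
    moreover have "t div 2 ^ (j - i) < t"
      using \<open>i < j\<close> assms(3) by (intro div_less_dividend one_less_power) auto
    ultimately show False by simp
  qed
  show ?thesis using less[OF assms(1,2)] less[OF assms(2,1)] by simp
qed

lemma div2_level: "(a::nat) div 2 div 2 ^ j = a div 2 ^ Suc j"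
  by (simp add: div_mult2_eq)

lemma level_mono_div4: "(a::nat) div 2 ^ j = 4 * t + c \<Longrightarrow> c < 4 \<Longrightarrow> a div 2 ^ (j + 2) = t"
  unfolding power_add div_mult2_eq by simp

lemma finite_subheap: "finite (subheap t d)"
proof -
  have "subheap t d \<subseteq> {..<Suc t * 2 ^ d}"
  proof
    fix a assume "a \<in> subheap t d"
    then obtain j where j: "j < d" "a div 2 ^ j = t" by (auto simp: subheap_def)
    have "a < t * 2 ^ j + 2 ^ j"
      using dividend_less_div_times[of "2 ^ j" a] j by simp
    also have "\<dots> \<le> Suc t * 2 ^ d"
      using j(1) mult_le_mono2[of "2 ^ j" "2 ^ d" "Suc t"] by (simp add: add.commute)
    finally show "a \<in> {..<Suc t * 2 ^ d}" by simp
  qed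
  then show ?thesis by (rule finite_subset) simp
qed

text \<open>The deepest level alone consists of \<open>2 ^ d\<close> consecutive numbers.\<close>

lemma card_subheap: "2 ^ d \<le> card (subheap t (Suc d))"
proof -
  have "{t * 2 ^ d..<t * 2 ^ d + 2 ^ d} \<subseteq> subheap t (Suc d)"
    by (auto simp: subheap_def intro!: exI[of _ d] div_nat_eqI simp: mult.commute)
  from card_mono[OF finite_subheap this] show ?thesis by simp
qed

lemma subheap_root_subset: "subheap 1 h \<subseteq> {1..<2 ^ h}"
proof
  fix a assume "a \<in> subheap 1 h"
  then obtain j where j: "j < h" "a div 2 ^ j = 1" by (auto simp: subheap_def)
  have "a < 2 ^ Suc j"
    using dividend_less_div_times[of "2 ^ j" a] j by simp
  also have "\<dots> \<le> 2 ^ h" using j(1) by (intro power_increasing) auto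
  finally show "a \<in> {1..<2 ^ h}" using j(2) by (cases "a = 0") auto
qed

lemma rooted_subheap:
  assumes "t > 0" "d > 0"
  shows "rooted t (subheap t d)"
  unfolding rooted_def
proof (intro conjI ballI impI)
  fix a assume a: "a \<in> subheap t d" "a \<noteq> t"
  then obtain j where j: "j < d" "a div 2 ^ j = t" by (auto simp: subheap_def)
  then obtain i where "j = Suc i" using a(2) by (cases j) auto
  then show "a div 2 \<in> subheap t d"
    using j div2_level[of a i] by (auto simp: subheap_def intro!: exI[of _ i])
qed (use assms in \<open>auto simp: subheap_def intro: exI[of _ 0]\<close>)

text \<open>The grandchildren of \<open>t\<close> are the numbers \<open>4 * t + c\<close> with
  \<open>c < 4\<close>; depth \<open>j\<close> below one of them is depth \<open>j + 2\<close> below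
  \<open>t\<close>.\<close>

lemma subheap_grandchild_subset:
  assumes "c < 4"
  shows "subheap (4 * t + c) d \<subseteq> subheap t (d + 2)"
proof
  fix a assume "a \<in> subheap (4 * t + c) d"
  then obtain j where "j < d" "a div 2 ^ j = 4 * t + c" by (auto simp: subheap_def)
  then show "a \<in> subheap t (d + 2)"
    using level_mono_div4[of a j t c] assms by (auto simp: subheap_def intro!: exI[of _ "j + 2"])
qed

text \<open>A common node would have the same depth below both grandchildren, by uniqueness of its
  depth below \<open>t\<close>, and so the same ancestor there.\<close>

lemma subheap_grandchild_disjoint:
  assumes "t > 0" "b < 4" "c < 4" "b \<noteq> c"
  shows "subheap (4 * t + b) d \<inter> subheap (4 * t + c) d = {}"
proof (rule ccontr)
  assume "\<not> ?thesis"
  then obtain a i j where a: "a div 2 ^ i = 4 * t + b" "a div 2 ^ j = 4 * t + c"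
    by (auto simp: subheap_def)
  have "i + 2 = j + 2"
    by (rule subheap_level_unique[of a _ t]) (use level_mono_div4 a assms in auto)
  then show False using a assms(4) by simp
qed

text \<open>Cutting off a whole branch keeps the rest closed under parents: a node of the tree whose
  parent lies in the branch lies in the branch itself.\<close>

lemma rooted_subheap_minus_grandchild:
  assumes "t > 0" "c < 4"
  shows "rooted t (subheap t (d + 2) - subheap (4 * t + c) d)"
proof -
  have root: "rooted t (subheap t (d + 2))" using assms by (intro rooted_subheap) auto
  have "a \<in> subheap (4 * t + c) d" if a: "a \<in> subheap t (d + 2)" "a div 2 \<in> subheap (4 * t + c) d" for a
  proof -
    obtain j where j: "a div 2 ^ Suc j = 4 * t + c"
      using a(2) div2_level by (auto simp: subheap_def)
    obtain i where i: "i < d + 2" "a div 2 ^ i = t" using a(1) by (auto simp: subheap_def)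
    \<comment> \<open>Uniqueness of depth turns the bound \<open>i < d + 2\<close> into
      \<open>Suc j < d\<close>, so \<open>a\<close> is not too deep for the branch.\<close>
    have "i = Suc j + 2"
      by (rule subheap_level_unique[OF i(2) level_mono_div4[OF j assms(2)] assms(1)])
    then show ?thesis using i(1) j by (auto simp: subheap_def intro!: exI[of _ "Suc j"])
  qed
  moreover have "t \<notin> subheap (4 * t + c) d"
  proof
    assume "t \<in> subheap (4 * t + c) d"
    then obtain j where "t div 2 ^ j = 4 * t + c" by (auto simp: subheap_def)
    then have "4 * t + c \<le> t" by (metis div_le_dividend)
    then show False using assms(1) by simp
  qed
  ultimately show ?thesis using root unfolding rooted_def by blast
qed

section \<open>Large cuts along a growing sequence of vertex sets\<close>

lemma touched_mono: "S \<subseteq> S' \<Longrightarrow> X \<subseteq> X' \<Longrightarrow> touched p S X \<subseteq> touched p S' X'"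
  by (auto simp: touched_def)

lemma finite_touched: "finite S \<Longrightarrow> finite (touched p S X)"
  by (auto simp: touched_def)

text \<open>
  Along a growing sequence of sets, three of the four grandchild subtrees reach a large cut, say at
  times \<open>a \<le> b \<le> c\<close>. At time \<open>b\<close> the first of them already meets the set in many columns and the
  last still misses many columns, so the remainder of the tree outside the second one, being
  connected, contributes \<open>p\<close> further arcs.
\<close>

lemma large_cut_in_sequence:
  fixes X :: "nat \<Rightarrow> nat set"
  assumes "p > 0" "mono X" "X 0 = {}" "\<And>m. \<exists>x. X (Suc m) \<subseteq> insert x (X m)" "2 * p \<le> 2 ^ d"
    and "t > 0" "{v. v div p \<in> subheap t (Suc d + 2 * j)} \<subseteq> X L"
  shows "\<exists>m. p \<le> card (touched p (subheap t (Suc d + 2 * j)) (X m))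
    \<and> p \<le> card (touched p (subheap t (Suc d + 2 * j)) (- X m))
    \<and> Suc j * p \<le> card (cut_arcs p (subheap t (Suc d + 2 * j)) (X m))"
  using assms(6,7)
\<comment> \<open>The two bounds on touched columns are carried along because the next stage uses
  them, at the first and third grandchild, to obtain the further \<open>p\<close> arcs.\<close>
proof (induction j arbitrary: t)
  case 0
  define S where "S = subheap t (Suc d)"
  have fin: "finite S" by (simp add: S_def finite_subheap)
  have S: "2 * p \<le> card S" using assms(5) card_subheap[of d t] by (simp add: S_def)
  have "touched p S (X L) = S"
  proof -
    have "t' * p \<in> X L" if "t' \<in> S" for t' using that 0(2) assms(1) by (auto simp: S_def)
    then show ?thesis using assms(1) by (force simp: touched_def image_iff)
  qed
  then have ex: "p \<le> card (touched p S (X L))" using S by simp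
  \<comment> \<open>At the first time \<open>m\<close> with \<open>p\<close> touched columns,
    exactly \<open>p\<close> are touched, since one new vertex touches at most one new column. So at
    least \<open>p\<close> of the at least \<open>2 * p\<close> columns still avoid
    \<open>X m\<close>.\<close>
  define m where "m = (LEAST m. p \<le> card (touched p S (X m)))"
  have m: "p \<le> card (touched p S (X m))" unfolding m_def using ex by (rule LeastI)
  then obtain n where n: "m = Suc n"
    using assms(1,3) by (cases m) (auto simp: touched_def)
  have "card (touched p S (X n)) < p"
    using not_less_Least[of n "\<lambda>m. p \<le> card (touched p S (X m))"] n by (auto simp: m_def)
  moreover obtain x where x: "X m \<subseteq> insert x (X n)" using assms(4) n by blast
  have "touched p S (X m) \<subseteq> insert (x div p) (touched p S (X n))"
    using x unfolding touched_def by blast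
  then have "card (touched p S (X m)) \<le> card (insert (x div p) (touched p S (X n)))"
    using finite_touched[OF fin] by (intro card_mono) auto
  then have "card (touched p S (X m)) \<le> Suc (card (touched p S (X n)))"
    using finite_touched[OF fin, of p "X n"] by (simp add: card_insert_if split: if_splits)
  ultimately have "card (touched p S (X m)) \<le> p" by simp
  moreover have "S - touched p S (X m) \<subseteq> touched p S (- X m)"
  proof
    fix t' assume "t' \<in> S - touched p S (X m)"
    then have t': "t' \<in> S" "t' = t' * p div p" "t' \<notin> (\<lambda>v. v div p) ` X m"
      using assms(1) by (auto simp: touched_def)
    then have "t' * p \<in> - X m" by (metis ComplI imageI)
    with t'(1,2) show "t' \<in> touched p S (- X m)" unfolding touched_def by blast
  qed
  then have "card S - card (touched p S (X m)) \<le> card (touched p S (- X m))"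
    using diff_card_le_card_Diff[OF finite_touched[OF fin]] card_mono[OF finite_touched[OF fin]]
    by (meson le_trans)
  ultimately have "p \<le> card (touched p S (- X m))" using S by simp
  then show ?case
    using m card_cut_arcs_ge[OF assms(1) fin rooted_subheap[OF 0(1), of "Suc d", folded S_def]]
    by (auto simp: S_def)
next
  case (Suc j)
  define D where "D = Suc d + 2 * j"
  define S where "S = subheap t (D + 2)"
  define U where "U c = subheap (4 * t + c) D" for c
  have fin: "finite S" "finite (U c)" for c by (simp_all add: S_def U_def finite_subheap)
  have US: "U c \<subseteq> S" if "c < 4" for c
    using subheap_grandchild_subset[OF that] by (simp add: U_def S_def)
  have disj: "U b \<inter> U c = {}" if "b < 4" "c < 4" "b \<noteq> c" for b c
    using subheap_grandchild_disjoint[OF Suc.prems(1) that] by (simp add: U_def)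
  have S: "subheap t (Suc d + 2 * Suc j) = S" by (simp add: S_def D_def)
  have "\<exists>m. p \<le> card (touched p (U c) (X m)) \<and> p \<le> card (touched p (U c) (- X m))
      \<and> Suc j * p \<le> card (cut_arcs p (U c) (X m))" if "c < 4" for c
    unfolding U_def D_def
  proof (rule Suc.IH)
    have "{v. v div p \<in> U c} \<subseteq> {v. v div p \<in> S}" using US[OF that] by blast
    then show "{v. v div p \<in> subheap (4 * t + c) (Suc d + 2 * j)} \<subseteq> X L"
      using Suc.prems(2) unfolding S U_def D_def by blast
  qed (use Suc.prems(1) in simp)
  then obtain f where f: "p \<le> card (touched p (U c) (X (f c)))" "p \<le> card (touched p (U c) (- X (f c)))"
      "Suc j * p \<le> card (cut_arcs p (U c) (X (f c)))" if "c < 4" for c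
    by metis
  have "\<exists>a<4. \<exists>b<4. \<exists>c<4. a \<noteq> b \<and> b \<noteq> c \<and> f a \<le> f b \<and> f b \<le> f c"
  proof -
    have "(0::nat) < 4" "(1::nat) < 4" "(2::nat) < 4" "(0::nat) \<noteq> 1" "(0::nat) \<noteq> 2" "(1::nat) \<noteq> 2" by simp_all
    then show ?thesis by (metis nle_le)
  qed
  then obtain a b c where abc: "a < 4" "b < 4" "c < 4" "a \<noteq> b" "b \<noteq> c" "f a \<le> f b" "f b \<le> f c"
    by blast
  let ?Y = "X (f b)" and ?R = "S - U b"
  have sub: "touched p (U a) (X (f a)) \<subseteq> touched p ?R ?Y"
      "touched p (U c) (- X (f c)) \<subseteq> touched p ?R (- ?Y)"
    using US[OF abc(1)] US[OF abc(3)] disj[OF abc(1,2,4)] disj[OF abc(2,3,5)]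
      monoD[OF assms(2) abc(6)] monoD[OF assms(2) abc(7)]
    by (intro touched_mono; blast)+
  have R: "p \<le> card (touched p ?R ?Y)" "p \<le> card (touched p ?R (- ?Y))"
    using f(1)[OF abc(1)] f(2)[OF abc(3)] card_mono[OF finite_touched sub(1)]
      card_mono[OF finite_touched sub(2)] fin by auto
  have "rooted t ?R"
    unfolding S_def U_def by (rule rooted_subheap_minus_grandchild[OF Suc.prems(1) abc(2)])
  then have cutR: "p \<le> card (cut_arcs p ?R ?Y)"
    using card_cut_arcs_ge[OF assms(1) _ _ R] fin by blast
  have "cut_arcs p (U b) ?Y \<union> cut_arcs p ?R ?Y \<subseteq> cut_arcs p S ?Y"
    using US[OF abc(2)] by (auto simp: cut_arcs_def)
  then have "card (cut_arcs p (U b) ?Y \<union> cut_arcs p ?R ?Y) \<le> card (cut_arcs p S ?Y)"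
    by (rule card_mono[OF finite_cut_arcs[OF assms(1) fin(1)]])
  \<comment> \<open>The two cuts live over disjoint node sets, so their bounds
    \<open>Suc j * p\<close> and \<open>p\<close> add up.\<close>
  moreover have "card (cut_arcs p (U b) ?Y \<union> cut_arcs p ?R ?Y)
      = card (cut_arcs p (U b) ?Y) + card (cut_arcs p ?R ?Y)"
    using fin by (intro card_Un_disjoint finite_cut_arcs assms(1)) (auto simp: cut_arcs_def)
  ultimately have "Suc (Suc j) * p \<le> card (cut_arcs p S ?Y)"
    using f(3)[OF abc(2)] cutR by simp
  moreover have "card (touched p ?R ?Y) \<le> card (touched p S ?Y)"
      "card (touched p ?R (- ?Y)) \<le> card (touched p S (- ?Y))"
    by (intro card_mono finite_touched fin touched_mono; blast)+
  ultimately show ?case using R unfolding S by (metis le_trans)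
qed

section \<open>From edge cuts to distant matchings\<close>

lemma card_UN_le_mult:
  assumes "finite A" "\<And>x. x \<in> A \<Longrightarrow> card (f x) \<le> n"
  shows "card (\<Union>x\<in>A. f x) \<le> card A * n"
  using card_UN_le[OF assms(1), of f] sum_bounded_above[of A "\<lambda>x. card (f x)" n] assms(2) by simp

text \<open>By maximality, every cut edge has an end within distance 2 of one of the
  \<open>2 * card M\<close> vertices of a maximum crossing distant matching \<open>M\<close>. Two
  steps lead to that end and two more name the edge, each with at most \<open>Suc D\<close>
  choices.\<close>

lemma card_cut_le_distant_matching:
  assumes "pair_graph G" "\<And>v. card {w. (v, w) \<in> parcs G} \<le> D"
  shows "card {(u, v) \<in> parcs G. u \<in> V1 \<and> v \<notin> V1} \<le> 2 * Suc D ^ 4 * max_crossing_distant_matching G V1"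
proof -
  interpret pair_graph G by fact
  define C where "C = {M. distant_matching G M \<and> (\<forall>e\<in>M. crosses G V1 e)}"
  have "finite (uedges G)"
  proof -
    have "uedges G = (\<lambda>(u, v). {u, v}) ` parcs G" by (auto simp: uedges_def)
    then show ?thesis by (simp add: pair_finite_arcs)
  qed
  moreover have CU: "C \<subseteq> Pow (uedges G)" by (auto simp: C_def distant_matching_def matching_def)
  ultimately have fin: "finite C" "finite M" if "M \<in> C" for M
    using that finite_subset by (blast, blast)
  \<comment> \<open>The empty matching makes the set under \<open>Max\<close> nonempty.\<close>
  have empty: "{} \<in> C" by (simp add: C_def distant_matching_def matching_def)
  have mcdm: "max_crossing_distant_matching G V1 = Max (card ` C)"
    unfolding max_crossing_distant_matching_def C_def by (rule arg_cong[where f = Max]) auto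
  have "Max (card ` C) \<in> card ` C" using fin(1)[OF empty] empty by (intro Max_in) auto
  then obtain M where M: "M \<in> C" "card M = Max (card ` C)" by auto
  have max: "card M' \<le> card M" if "M' \<in> C" for M' using fin(1)[OF that] that M(2) by simp
  \<comment> \<open>Closed neighbourhoods, so that walks may pause and shorter distances need no
    separate cases.\<close>
  define N where "N v = insert v {w. (v, w) \<in> parcs G}" for v
  have N: "finite (N v)" "card (N v) \<le> Suc D" for v
  proof -
    have "{w. (v, w) \<in> parcs G} \<subseteq> pverts G" using in_arcsD2 by auto
    then have "finite {w. (v, w) \<in> parcs G}" by (rule finite_subset) (rule pair_finite_verts)
    then show "finite (N v)" "card (N v) \<le> Suc D"
      using assms(2)[of v] by (auto simp: N_def card_insert_if)
  qed
  have cover: "{(u, v) \<in> parcs G. u \<in> V1 \<and> v \<notin> V1}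
      \<subseteq> (\<Union>b\<in>\<Union>M. \<Union>x\<in>N b. \<Union>y\<in>N x. \<Union>z\<in>N y. Pair z ` N z)"
  proof clarify
    fix u v assume uv: "(u, v) \<in> parcs G" "u \<in> V1" "v \<notin> V1"
    \<comment> \<open>If both ends were at distance at least 3 from every matched vertex,
      \<open>{u, v}\<close> could be added to \<open>M\<close>.\<close>
    have near: "\<exists>b\<in>\<Union>M. \<exists>x\<in>N b. \<exists>a\<in>N x. a \<in> {u, v}"
    proof (rule ccontr)
      assume far: "\<not> ?thesis"
      have e: "{u, v} \<in> uedges G" using uv by (auto simp: uedges_def)
      have cr: "crosses G V1 {u, v}" using uv in_arcsD2 by (auto simp: crosses_def)
      have no: "a \<noteq> b" "(a, b) \<notin> parcs G" "(b, a) \<notin> parcs G"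
          "\<not> (\<exists>w. (a, w) \<in> parcs G \<and> (b, w) \<in> parcs G)"
          "\<not> (\<exists>w. (b, w) \<in> parcs G \<and> (a, w) \<in> parcs G)"
        if "a \<in> {u, v}" "b \<in> f" "f \<in> M" for a b f
      proof -
        have "b \<in> \<Union>M" using that by blast
        then have out: "a \<notin> N x" if "x \<in> N b" for x using far \<open>a \<in> {u, v}\<close> that by blast
        show "a \<noteq> b" "(b, a) \<notin> parcs G" using out[of b] by (auto simp: N_def)
        then show "(a, b) \<notin> parcs G" using arcs_symmetric by blast
        have *: "\<not> ((a, w) \<in> parcs G \<and> (b, w) \<in> parcs G)" for w
          using out[of w] arcs_symmetric[of a w] by (auto simp: N_def)
        then show "\<not> (\<exists>w. (a, w) \<in> parcs G \<and> (b, w) \<in> parcs G)"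
          "\<not> (\<exists>w. (b, w) \<in> parcs G \<and> (a, w) \<in> parcs G)" by blast+
      qed
      have "{u, v} \<notin> M" using no(1)[of u u] by blast
      have "insert {u, v} M \<in> C"
        unfolding C_def distant_matching_def matching_def mem_Collect_eq
      proof (intro conjI ballI impI)
        show "insert {u, v} M \<subseteq> uedges G" using e M(1) CU by auto
        show "pairwise disjnt (insert {u, v} M)"
          using M(1) no(1) by (auto simp: C_def distant_matching_def matching_def pairwise_insert disjnt_def)
      next
        fix f g a b assume "f \<in> insert {u, v} M" "g \<in> insert {u, v} M" "f \<noteq> g" "a \<in> f" "b \<in> g"
        then consider "f \<in> M" "g \<in> M" | "a \<in> {u, v}" "g \<in> M" | "b \<in> {u, v}" "f \<in> M" by blast
        note cases = this
        have old: "(a, b) \<notin> parcs G \<and> \<not> (\<exists>w. (a, w) \<in> parcs G \<and> (b, w) \<in> parcs G)" if "f \<in> M" "g \<in> M"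
          using M(1) that \<open>f \<noteq> g\<close> \<open>a \<in> f\<close> \<open>b \<in> g\<close> unfolding C_def distant_matching_def by blast
        show "(a, b) \<notin> parcs G"
          using cases old no(2)[of a b g] no(3)[of b a f] \<open>a \<in> f\<close> \<open>b \<in> g\<close> by cases auto
        show "\<not> (\<exists>w. (a, w) \<in> parcs G \<and> (b, w) \<in> parcs G)"
          using cases old no(4)[of a b g] no(5)[of b a f] \<open>a \<in> f\<close> \<open>b \<in> g\<close> by cases auto
      next
        fix f assume "f \<in> insert {u, v} M"
        then show "crosses G V1 f" using cr M(1) by (auto simp: C_def)
      qed
      from max[OF this] show False using \<open>{u, v} \<notin> M\<close> fin(2)[OF M(1)] by simp
    qed
    then obtain b x a where bxa: "b \<in> \<Union>M" "x \<in> N b" "a \<in> N x" "a \<in> {u, v}" by blast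
    \<comment> \<open>Whichever end \<open>a\<close> is, one step, possibly a pause, leads to
      \<open>u\<close>, and one more to \<open>v\<close>.\<close>
    have "u \<in> N a" "v \<in> N u" using bxa(4) uv(1) arcs_symmetric by (auto simp: N_def)
    then show "(u, v) \<in> (\<Union>b\<in>\<Union>M. \<Union>x\<in>N b. \<Union>y\<in>N x. \<Union>z\<in>N y. Pair z ` N z)"
      using bxa by blast
  qed
  have finM: "finite (\<Union>M)" "card (\<Union>M) \<le> card M * 2"
  proof -
    have "finite e \<and> card e \<le> 2" if "e \<in> M" for e
    proof -
      have "e \<in> uedges G" using that M(1) CU by blast
      then show ?thesis by (auto simp: uedges_def card_insert_if)
    qed
    then show "finite (\<Union>M)" "card (\<Union>M) \<le> card M * 2"
      using fin(2)[OF M(1)] card_UN_le_mult[of M "\<lambda>e. e" 2] by auto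
  qed
  have "card {(u, v) \<in> parcs G. u \<in> V1 \<and> v \<notin> V1}
      \<le> card (\<Union>b\<in>\<Union>M. \<Union>x\<in>N b. \<Union>y\<in>N x. \<Union>z\<in>N y. Pair z ` N z)"
    by (intro card_mono cover finite_UN_I finite_imageI N(1) finM(1))
  also have "\<dots> \<le> card (\<Union>M) * Suc D ^ 4"
  proof (rule card_UN_le_mult[OF finM(1)])
    have step: "card (\<Union>y\<in>N x. f y) \<le> Suc D * n" if "\<And>y. card (f y) \<le> n" for x n and f :: "'a \<Rightarrow> ('a \<times> 'a) set"
      using card_UN_le_mult[OF N(1), of x f n] that mult_le_mono1[OF N(2)[of x], of n] by fastforce
    have "card (Pair z ` N z) \<le> Suc D" for z using card_image_le[OF N(1)] N(2) le_trans by blast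
    then have "card (\<Union>x\<in>N b. \<Union>y\<in>N x. \<Union>z\<in>N y. Pair z ` N z) \<le> Suc D * (Suc D * (Suc D * Suc D))" for b
      by (intro step)
    then show "card (\<Union>x\<in>N b. \<Union>y\<in>N x. \<Union>z\<in>N y. Pair z ` N z) \<le> Suc D ^ 4" for b
      by (simp add: numeral_eq_Suc)
  qed
  also have "\<dots> \<le> 2 * Suc D ^ 4 * card M" using mult_le_mono1[OF finM(2), of "Suc D ^ 4"] by (simp add: mult_ac)
  finally show ?thesis using M(2) mcdm by simp
qed

section \<open>Distant matching width from an optimal ordering\<close>

lemma dmw_ordering:
  assumes "finite (pverts G)"
  obtains xs where "xs \<in> permutations_of_set (pverts G)"
    and "\<And>m. max_crossing_distant_matching G (set (take m xs)) \<le> dmw G"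
proof -
  define g where "g SV = Max ((\<lambda>xs. max_crossing_distant_matching G (set xs)) ` set (prefixes SV))" for SV
  have "dmw G \<in> g ` permutations_of_set (pverts G)"
    unfolding dmw_def g_def using assms by (intro Min_in) auto
  then obtain xs where xs: "xs \<in> permutations_of_set (pverts G)" "dmw G = g xs" by auto
  have "max_crossing_distant_matching G (set (take m xs)) \<le> dmw G" for m
    unfolding xs(2) g_def by (intro Max_ge) (auto simp: take_is_prefix)
  with xs(1) show thesis by (rule that)
qed

text \<open>The prefixes of an optimal ordering form a growing sequence, and one of them has a large
  cut. The constant is \<open>2592 = 2 * 6 ^ 4\<close>, from degree bound 5.\<close>

lemma dmw_heap_grid:
  assumes "p > 0" "2 * p \<le> 2 ^ d"
  shows "Suc j * p \<le> 2592 * dmw (heap_grid p (Suc d + 2 * j))"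
proof -
  define h where "h = Suc d + 2 * j"
  define G where "G = heap_grid p h"
  have verts: "pverts G = {p..<p * 2 ^ h}" by (simp add: G_def heap_grid_def)
  obtain xs where xs: "xs \<in> permutations_of_set (pverts G)"
      "\<And>m. max_crossing_distant_matching G (set (take m xs)) \<le> dmw G"
    using dmw_ordering[of G] by (auto simp: verts)
  define X where "X m = set (take m xs)" for m
  have in_verts: "u \<in> pverts G" if "u div p \<in> subheap 1 h" for u
    using subheap_root_subset that heap_grid_vert_iff[OF assms(1), of u h] unfolding verts by blast
  have "\<exists>m. p \<le> card (touched p (subheap 1 h) (X m)) \<and> p \<le> card (touched p (subheap 1 h) (- X m))
      \<and> Suc j * p \<le> card (cut_arcs p (subheap 1 h) (X m))"
    unfolding h_def
  proof (rule large_cut_in_sequence)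
    show "mono X" by (intro monoI, unfold X_def, rule set_take_subset_set_take)
    show "\<exists>x. X (Suc m) \<subseteq> insert x (X m)" for m
      by (cases "m < length xs") (auto simp: X_def take_Suc_conv_app_nth)
    show "{v. v div p \<in> subheap 1 (Suc d + 2 * j)} \<subseteq> X (length xs)"
      using in_verts xs(1) by (auto simp: X_def h_def permutations_of_set_def)
  qed (use assms in \<open>auto simp: X_def\<close>)
  then obtain m where m: "Suc j * p \<le> card (cut_arcs p (subheap 1 h) (X m))" by blast
  have pg: "pair_graph G" unfolding G_def by (rule pair_graph_heap_grid[OF assms(1)])
  interpret pair_graph G by (rule pg)
  have "cut_arcs p (subheap 1 h) (X m) \<subseteq> {(u, v) \<in> parcs G. u \<in> X m \<and> v \<notin> X m}"
    using in_verts verts by (auto simp: cut_arcs_def G_def heap_grid_def)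
  then have "card (cut_arcs p (subheap 1 h) (X m)) \<le> card {(u, v) \<in> parcs G. u \<in> X m \<and> v \<notin> X m}"
    by (intro card_mono finite_subset[OF _ pair_finite_arcs]) auto
  also have "\<dots> \<le> 2 * Suc 5 ^ 4 * max_crossing_distant_matching G (X m)"
    using card_heap_grid_neighbours[OF assms(1)] by (intro card_cut_le_distant_matching pg) (simp add: G_def)
  also have "\<dots> \<le> 2592 * dmw G" using xs(2)[of m] by (simp add: X_def)
  finally show ?thesis using m by (simp add: G_def h_def)
qed

section \<open>The infinite class and its constants\<close>

lemma digraph_iso_card_pverts:
  assumes "digraph_iso (with_proj G) (with_proj H)"
  shows "card (pverts G) = card (pverts H)"
proof -
  obtain f where f: "pre_digraph.digraph_isomorphism (with_proj G) f" "with_proj H = app_iso f (with_proj G)"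
    using assms by (auto simp: digraph_iso_def)
  have "pverts H = iso_verts f ` pverts G"
    using arg_cong[OF f(2), of verts] by (simp add: verts_app_iso)
  moreover have "inj_on (iso_verts f) (pverts G)"
    using f(1) by (simp add: pre_digraph.digraph_isomorphism_def)
  ultimately show ?thesis by (simp add: card_image)
qed

text \<open>Bounding the factor \<open>p\<close> by \<open>2 ^ p\<close> gives exponent
  \<open>2 * p + 1 + 2 * j\<close>, at most \<open>5 * j\<close> because
  \<open>1 <= p <= j\<close>.\<close>

lemma log_card_heap_grid:
  assumes "p \<ge> 1" "j \<ge> p"
  shows "log 2 (real (card (pverts (heap_grid p (Suc p + 2 * j))))) \<le> 5 * real j"
proof -
  define n where "n = card (pverts (heap_grid p (Suc p + 2 * j)))"
  have n: "n = p * 2 ^ (Suc p + 2 * j) - p" by (simp add: n_def heap_grid_def)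
  have "(1::nat) < 2 ^ (Suc p + 2 * j)" by (intro one_less_power) auto
  then have "n > 0" using assms(1) by (simp add: n)
  have "n \<le> 2 ^ p * 2 ^ (Suc p + 2 * j)"
    unfolding n using less_exp[of p] by (intro order_trans[OF diff_le_self] mult_le_mono1) simp
  also have "\<dots> = 2 ^ (p + (Suc p + 2 * j))" by (simp only: power_add)
  finally have "real n \<le> real (2 ^ (p + (Suc p + 2 * j)))" by (rule of_nat_mono)
  then have "log 2 (real n) \<le> log 2 (2 ^ (p + (Suc p + 2 * j)))"
    using \<open>n > 0\<close> by (intro log_mono) auto
  also have "\<dots> = real (p + (Suc p + 2 * j))" by (subst log_nat_power) simp_all
  also have "\<dots> \<le> 5 * real j" using assms by simp
  finally show ?thesis by (simp add: n_def)
qed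

text \<open>This permits \<open>d = p\<close> as the depth parameter of the base subtrees.\<close>

lemma two_mult_le_power2: "2 * n \<le> 2 ^ n" for n :: nat
proof (cases n)
  case (Suc m)
  then show ?thesis using Suc_leI[OF less_exp[of m]] by simp
qed simp

theorem theorem3:
  shows "\<exists>b::real. b > 0 \<and>
    (\<forall>k::nat. k \<ge> 50 \<longrightarrow>
      (\<exists>\<G> :: nat pair_pre_digraph set.
         infinite \<G> \<and>
         pairwise (\<lambda>G H. \<not> digraph_iso (with_proj G) (with_proj H)) \<G> \<and>
         (\<forall>G\<in>\<G>.
            pair_graph G \<and>
            (\<forall>v\<in>pverts G. out_degree (with_proj G) v \<le> 5) \<and>
            treewidth G \<le> k \<and>
            real (dmw G) \<ge> (log 2 (real (card (pverts G))) * real k) / b)))"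
  \<comment> \<open>\<open>38880 = 5 * 3 * 2592\<close>, from \<open>log n \<le> 5j\<close>, \<open>k \<le> 3p\<close> and \<open>j * p \<le> 2592 * dmw\<close>\<close>
proof (intro exI[of _ "38880::real"] conjI allI impI)
  fix k :: nat assume k: "k \<ge> 50"
  \<comment> \<open>Bags of size \<open>2 * p\<close> give treewidth at most
    \<open>2 * p - 1 <= k\<close>, while \<open>k <= 2 * p + 1 <= 3 * p\<close>.\<close>
  define p where "p = k div 2"
  have p: "p \<ge> 1" "2 * p - 1 \<le> k" "k \<le> 3 * p" using k by (auto simp: p_def)
  define F where "F j = heap_grid p (Suc p + 2 * j)" for j
  have card_F: "card (pverts (F i)) = card (pverts (F j)) \<longleftrightarrow> i = j" for i j
  proof -
    have "p \<le> p * 2 ^ n" for n :: nat by simp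
    then have "p * 2 ^ (Suc p + 2 * i) - p = p * 2 ^ (Suc p + 2 * j) - p \<longleftrightarrow>
        p * 2 ^ (Suc p + 2 * i) = p * 2 ^ (Suc p + 2 * j)"
      by (intro eq_diff_iff)
    also have "\<dots> \<longleftrightarrow> i = j" using p(1) by simp
    finally show ?thesis by (simp add: F_def heap_grid_def)
  qed
  have inj: "inj_on F {p..}" by (rule inj_onI) (metis card_F)
  show "\<exists>\<G> :: nat pair_pre_digraph set.
         infinite \<G> \<and>
         pairwise (\<lambda>G H. \<not> digraph_iso (with_proj G) (with_proj H)) \<G> \<and>
         (\<forall>G\<in>\<G>.
            pair_graph G \<and>
            (\<forall>v\<in>pverts G. out_degree (with_proj G) v \<le> 5) \<and>
            treewidth G \<le> k \<and>
            real (dmw G) \<ge> (log 2 (real (card (pverts G))) * real k) / 38880)"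
  \<comment> \<open>Starting at \<open>j = p\<close> makes the logarithm of the number of vertices
    at most \<open>5 * j\<close>; different \<open>j\<close> give different vertex counts, hence
    non-isomorphic graphs.\<close>
  proof (intro exI[of _ "F ` {p..}"] conjI ballI)
    show "infinite (F ` {p..})" using inj by (simp add: finite_image_iff infinite_Ici)
    show "pairwise (\<lambda>G H. \<not> digraph_iso (with_proj G) (with_proj H)) (F ` {p..})"
      by (auto simp: pairwise_def dest!: digraph_iso_card_pverts simp: card_F)
  next
    fix G assume "G \<in> F ` {p..}"
    then obtain j where j: "j \<ge> p" "G = F j" by auto
    show "pair_graph G" using pair_graph_heap_grid p by (simp add: j(2) F_def)
    show "out_degree (with_proj G) v \<le> 5" for v
      using card_heap_grid_neighbours[of p v] p by (simp add: out_degree_with_proj j(2) F_def)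
    show "treewidth G \<le> k"
      using treewidth_heap_grid[of p "Suc p + 2 * j"] p unfolding j(2) F_def by linarith
    have "Suc j * p \<le> 2592 * dmw G"
      using dmw_heap_grid[of p p j] two_mult_le_power2 p by (simp add: j(2) F_def)
    then have dmw: "real j * real p \<le> 2592 * real (dmw G)"
      by (metis (mono_tags, lifting) le_add2 le_trans mult_Suc of_nat_le_iff of_nat_mult of_nat_numeral)
    have "log 2 (real (card (pverts G))) * real k \<le> (5 * real j) * (3 * real p)"
      using log_card_heap_grid[OF p(1) j(1)] p(3) by (intro mult_mono) (auto simp: j(2) F_def)
    then show "real (dmw G) \<ge> (log 2 (real (card (pverts G))) * real k) / 38880"
      using dmw by (simp add: field_simps)
  qed
qed simp

end
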